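(* Let $G$ be a finite abstract simplicial complex, and let $K$ be its counting matrix, with entries $K(x,y)=|W^-(x)\cap W^-(y)|$ for $x,y\in G$. Then $K$ and $K^{-1}$ have the same spectrum (eigenvalues counted with multiplicity).
   Context: A finite abstract simplicial complex $G$ is a finite set of non-empty finite sets that is closed under taking non-empty subsets (the empty set is not an element of $G$). For $x\in G$, the core of $x$ is $W^-(x)=\{u\in G : u\subseteq x\}$, i.e. the set of all non-empty subsets of $x$. The counting matrix $K$ of $G$ has its rows and columns indexed by the elements of $G$ (in some fixed order, the same for rows and columns), with $K(x,y)=|W^-(x)\cap W^-(y)|=2^{|x\cap y|}-1$. The matrix $K$ has determinant $1$, hence is invertible. *)

theory Defs
  imports
    "Jordan_Normal_Form.Spectral_Radius"
    "HOL-Computational_Algebra.Fundamental_Theorem_Algebra"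
begin

definition finite_abstract_simplicial_complex :: "'v set set \<Rightarrow> bool" where
  "finite_abstract_simplicial_complex G \<longleftrightarrow>
     finite G \<and> (\<forall>x\<in>G. finite x \<and> x \<noteq> {}) \<and>
     (\<forall>x\<in>G. \<forall>u. u \<subseteq> x \<and> u \<noteq> {} \<longrightarrow> u \<in> G)"

definition core :: "'v set set \<Rightarrow> 'v set \<Rightarrow> 'v set set" where
  "core G x = {u \<in> G. u \<subseteq> x}"

text \<open>
  The list \<open>xs\<close> enumerates the complex \<open>set xs\<close> without repetition and fixes the common order
  of rows and columns. The entries are natural numbers, embedded into the complex numbers so
  that all eigenvalues are available in the coefficient field.
\<close>

definition counting_matrix :: "'v set list \<Rightarrow> complex mat" where
  "counting_matrix xs = mat (length xs) (length xs)
     (\<lambda>(i, j). of_nat (card (core (set xs) (xs ! i) \<inter> core (set xs) (xs ! j))))"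

text \<open>
  The eigenvalues counted with algebraic multiplicity, that is, with their multiplicity as roots
  of the characteristic polynomial.
\<close>

definition spectrum_mset :: "complex mat \<Rightarrow> complex multiset" where
  "spectrum_mset A = proots (char_poly A)"

lemma set_mset_spectrum_mset:
  assumes A: "A \<in> carrier_mat n n"
  shows "set_mset (spectrum_mset A) = spectrum A"
proof -
  have "char_poly A \<noteq> 0"
    using degree_monic_char_poly[OF A] by auto
  then show ?thesis
    by (simp add: spectrum_mset_def spectrum_root_char_poly[OF A])
qed

lemma size_spectrum_mset:
  assumes A: "A \<in> carrier_mat n n"
  shows "size (spectrum_mset A) = n"
  using degree_monic_char_poly[OF A] by (simp add: spectrum_mset_def size_proots_complex)

lemma card_core_Int_core:
  assumes G: "finite_abstract_simplicial_complex G" and x: "x \<in> G"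
  shows "card (core G x \<inter> core G y) = 2 ^ card (x \<inter> y) - 1"
proof -
  have "core G x \<inter> core G y = Pow (x \<inter> y) - {{}}"
    using G x unfolding core_def finite_abstract_simplicial_complex_def by blast
  moreover have "finite (x \<inter> y)"
    using G x unfolding finite_abstract_simplicial_complex_def by blast
  ultimately show ?thesis
    by (simp add: card_Pow del: Pow_Int_eq)
qed

end

theory Submission
  imports Defs
begin

text \<open>
  Let \<open>Z\<close> be the zeta matrix of the face order, \<open>Z(x,u) = 1\<close> if \<open>u \<subseteq> x\<close> and \<open>0\<close> otherwise.
  A common face \<open>u\<close> of \<open>x\<close> and \<open>y\<close> contributes exactly one to the \<open>(x,y)\<close> entry of
  \<open>Z Z\<^sup>T\<close>, so \<open>K = Z Z\<^sup>T\<close>. With the diagonal matrix \<open>D(x,x) = (-1)\<^bsup>|x|\<^esup>\<close>, Moebius inversion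
  on the Boolean intervals of \<open>G\<close> reads \<open>Z\<inverse> = D Z D\<close>; in other words, the signed zeta matrix
  \<open>B = Z D\<close> is an involution (\<open>signed_zeta_mat_involution\<close>). As \<open>D D\<^sup>T = 1\<close>, also
  \<open>K = B B\<^sup>T\<close> (\<open>counting_matrix_factorization\<close>).

  The theorem is now a fact about any involution \<open>B\<close>: the transpose is an involution too, so
  \<open>(B B\<^sup>T)\<inverse> = B\<^sup>T B = B (B B\<^sup>T) B\<close>, which is the conjugate of \<open>B B\<^sup>T\<close> by \<open>B = B\<inverse>\<close>.
  Hence \<open>K\<close> and its inverse are similar and share their characteristic polynomial.
\<close>

definition signed_zeta_mat :: "'v set list \<Rightarrow> complex mat" where
  "signed_zeta_mat xs = mat (length xs) (length xs)
     (\<lambda>(i, j). if xs ! j \<subseteq> xs ! i then (-1) ^ card (xs ! j) else 0)"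

lemma signed_zeta_mat_carrier [simp]:
  "signed_zeta_mat xs \<in> carrier_mat (length xs) (length xs)"
  by (simp add: signed_zeta_mat_def)

lemma counting_matrix_carrier [simp]:
  "counting_matrix xs \<in> carrier_mat (length xs) (length xs)"
  by (simp add: counting_matrix_def)

lemma sum_nth_eq_sum_set:
  assumes "distinct xs"
  shows "(\<Sum>j = 0..<length xs. f (xs ! j)) = sum f (set xs)"
  using sum.reindex_bij_betw[OF bij_betw_nth[OF assms, of "{0..<length xs}" "set xs"]]
  by (simp add: atLeast0LessThan)

text \<open>
  The Moebius function of a Boolean interval: a nontrivial interval has as many sets of even
  as of odd cardinality.
\<close>

lemma sum_sign_interval:
  assumes "finite b"
  shows "(\<Sum>u | a \<subseteq> u \<and> u \<subseteq> b. (-1) ^ card u :: 'a :: ring_1) =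
    (if a = b then (-1) ^ card a else 0)"
proof -
  consider "a = b" | "\<not> a \<subseteq> b" | "a \<subset> b" by blast
  then show ?thesis
  proof cases
    case 1
    then have "{u. a \<subseteq> u \<and> u \<subseteq> b} = {a}" by blast
    with 1 show ?thesis by simp
  next
    case 2
    then have "{u. a \<subseteq> u \<and> u \<subseteq> b} = {}" by blast
    with 2 show ?thesis by (simp only: sum.empty) auto
  next
    case 3
    have "finite {u. a \<subseteq> u \<and> u \<subseteq> b}"
      by (rule finite_subset[of _ "Pow b"]) (use assms in auto)
    moreover have "card {u \<in> {u. a \<subseteq> u \<and> u \<subseteq> b}. even (card u)} =
        card {u \<in> {u. a \<subseteq> u \<and> u \<subseteq> b}. odd (card u)}"
      using card_subsupersets_even_odd[OF assms 3] by (simp add: conj_ac)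
    ultimately show ?thesis
      using 3 by (simp add: sum_alternating_cancels psubset_eq)
  qed
qed

text \<open>
  Closure under non-empty subsets makes each interval \<open>{u. a \<subseteq> u \<and> u \<subseteq> b}\<close> with \<open>a \<in> G\<close> and
  \<open>b \<in> G\<close> a full Boolean interval inside \<open>G\<close>: its members are non-empty because \<open>a\<close> is.
\<close>

lemma signed_zeta_mat_involution:
  assumes G: "finite_abstract_simplicial_complex (set xs)" and d: "distinct xs"
  shows "signed_zeta_mat xs * signed_zeta_mat xs = 1\<^sub>m (length xs)"
proof (rule eq_matI)
  fix i k
  assume "i < dim_row (1\<^sub>m (length xs) :: complex mat)"
    and "k < dim_col (1\<^sub>m (length xs) :: complex mat)"
  then have i: "i < length xs" and k: "k < length xs" by simp_all
  define a b where "a = xs ! k" and "b = xs ! i"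
  have ab: "a \<in> set xs" "b \<in> set xs"
    using i k by (simp_all add: a_def b_def)
  have interval: "{u \<in> set xs. a \<subseteq> u \<and> u \<subseteq> b} = {u. a \<subseteq> u \<and> u \<subseteq> b}"
    using G ab unfolding finite_abstract_simplicial_complex_def by blast
  have fin: "finite b"
    using G ab unfolding finite_abstract_simplicial_complex_def by blast
  have "(signed_zeta_mat xs * signed_zeta_mat xs) $$ (i, k) =
      (\<Sum>j = 0..<length xs. (if xs ! j \<subseteq> b then (-1) ^ card (xs ! j) else 0) *
        (if a \<subseteq> xs ! j then (-1) ^ card a else 0))"
    unfolding a_def b_def using i k by (simp add: signed_zeta_mat_def scalar_prod_def)
  also have "\<dots> = (\<Sum>u\<in>set xs. (if u \<subseteq> b then (-1) ^ card u else 0) *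
      (if a \<subseteq> u then (-1) ^ card a else 0))"
    by (rule sum_nth_eq_sum_set[OF d])
  also have "\<dots> = (\<Sum>u\<in>set xs. if a \<subseteq> u \<and> u \<subseteq> b then (-1) ^ card u * (-1) ^ card a else 0)"
    by (intro sum.cong) auto
  also have "\<dots> = (\<Sum>u | a \<subseteq> u \<and> u \<subseteq> b. (-1) ^ card u) * (-1) ^ card a"
    by (simp add: sum.inter_filter[symmetric] interval sum_distrib_right)
  also have "\<dots> = (if a = b then 1 else 0)"
    by (simp add: sum_sign_interval[OF fin] flip: power_mult_distrib)
  also have "\<dots> = 1\<^sub>m (length xs) $$ (i, k)"
    using i k d by (auto simp: a_def b_def nth_eq_iff_index_eq)
  finally show "(signed_zeta_mat xs * signed_zeta_mat xs) $$ (i, k) =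
      1\<^sub>m (length xs) $$ (i, k)" .
qed (simp_all add: signed_zeta_mat_def)

lemma counting_matrix_factorization:
  assumes d: "distinct xs"
  shows "counting_matrix xs = signed_zeta_mat xs * transpose_mat (signed_zeta_mat xs)"
proof (rule eq_matI)
  fix i k
  assume "i < dim_row (signed_zeta_mat xs * transpose_mat (signed_zeta_mat xs))"
    and "k < dim_col (signed_zeta_mat xs * transpose_mat (signed_zeta_mat xs))"
  then have i: "i < length xs" and k: "k < length xs"
    by (simp_all add: signed_zeta_mat_def)
  define a b where "a = xs ! k" and "b = xs ! i"
  have "(signed_zeta_mat xs * transpose_mat (signed_zeta_mat xs)) $$ (i, k) =
      (\<Sum>j = 0..<length xs. (if xs ! j \<subseteq> b then (-1) ^ card (xs ! j) else 0) *
        (if xs ! j \<subseteq> a then (-1) ^ card (xs ! j) else 0))"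
    unfolding a_def b_def using i k by (simp add: signed_zeta_mat_def scalar_prod_def)
  also have "\<dots> = (\<Sum>u\<in>set xs. (if u \<subseteq> b then (-1) ^ card u else 0) *
      (if u \<subseteq> a then (-1) ^ card u else 0))"
    by (rule sum_nth_eq_sum_set[OF d])
  also have "\<dots> = (\<Sum>u\<in>set xs. if u \<subseteq> b \<and> u \<subseteq> a then 1 else 0)"
    by (intro sum.cong) (auto simp flip: power_mult_distrib)
  also have "\<dots> = of_nat (card {u \<in> set xs. u \<subseteq> b \<and> u \<subseteq> a})"
    by (simp add: sum.inter_filter[symmetric])
  also have "{u \<in> set xs. u \<subseteq> b \<and> u \<subseteq> a} = core (set xs) b \<inter> core (set xs) a"
    by (auto simp: core_def)
  finally show "counting_matrix xs $$ (i, k) =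
      (signed_zeta_mat xs * transpose_mat (signed_zeta_mat xs)) $$ (i, k)"
    using i k by (simp add: counting_matrix_def a_def b_def)
qed (simp_all add: signed_zeta_mat_def counting_matrix_def)

text \<open>
  Both factors of \<open>B B\<^sup>T\<close> are their own inverses, so its inverse is \<open>B\<^sup>T B\<close>. It appears below as
  \<open>B K B\<close>, the form that exhibits it as a conjugate of \<open>K\<close>.
\<close>

lemma involution_times_transpose:
  fixes B :: "'a :: comm_ring_1 mat"
  assumes B [simp]: "B \<in> carrier_mat n n" and inv: "B * B = 1\<^sub>m n"
  defines "K \<equiv> B * transpose_mat B"
  shows "K * (B * K * B) = 1\<^sub>m n" and "(B * K * B) * K = 1\<^sub>m n"
proof -
  have T [simp]: "transpose_mat B \<in> carrier_mat n n"
    by simp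
  have invT: "transpose_mat B * transpose_mat B = 1\<^sub>m n"
    using transpose_mult[OF B B] inv by simp
  have "B * K = transpose_mat B"
    unfolding K_def using assoc_mult_mat[OF B B T] inv left_mult_one_mat[OF T] by simp
  then have conj: "B * K * B = transpose_mat B * B"
    by simp
  have "K * (B * K * B) = B * (transpose_mat B * (transpose_mat B * B))"
    unfolding conj unfolding K_def by (rule assoc_mult_mat[OF B T mult_carrier_mat[OF T B]])
  also have "transpose_mat B * (transpose_mat B * B) = B"
    using assoc_mult_mat[OF T T B] invT left_mult_one_mat[OF B] by simp
  finally show "K * (B * K * B) = 1\<^sub>m n"
    using inv by simp
  have "(B * K * B) * K = transpose_mat B * (B * (B * transpose_mat B))"
    unfolding conj unfolding K_def by (rule assoc_mult_mat[OF T B mult_carrier_mat[OF B T]])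
  also have "B * (B * transpose_mat B) = transpose_mat B"
    using assoc_mult_mat[OF B B T] inv left_mult_one_mat[OF T] by simp
  finally show "(B * K * B) * K = 1\<^sub>m n"
    using invT by simp
qed

theorem theorem5:
  fixes G :: "'v set set" and xs :: "'v set list"
  assumes "finite_abstract_simplicial_complex G"
    and "distinct xs" and "set xs = G"
  shows "invertible_mat (counting_matrix xs) \<and>
    (\<forall>L. inverts_mat (counting_matrix xs) L \<and> inverts_mat L (counting_matrix xs) \<longrightarrow>
      spectrum_mset (counting_matrix xs) = spectrum_mset L)"
proof -
  define n K B where "n = length xs" and "K = counting_matrix xs" and "B = signed_zeta_mat xs"
  have K: "K \<in> carrier_mat n n" and B: "B \<in> carrier_mat n n"
    by (simp_all add: n_def K_def B_def)
  have BB: "B * B = 1\<^sub>m n"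
    using signed_zeta_mat_involution[of xs] assms by (simp add: n_def B_def)
  have "K = B * transpose_mat B"
    using counting_matrix_factorization[OF assms(2)] by (simp add: K_def B_def)
  then have right: "K * (B * K * B) = 1\<^sub>m n" and left: "(B * K * B) * K = 1\<^sub>m n"
    using involution_times_transpose[OF B BB] by simp_all
  have C: "B * K * B \<in> carrier_mat n n"
    using B K by (meson mult_carrier_mat)
  have "invertible_mat K"
    unfolding invertible_mat_def inverts_mat_def square_mat.simps
    using left right K C by auto
  moreover have "spectrum_mset K = spectrum_mset L"
    if "inverts_mat K L" "inverts_mat L K" for L
  proof -
    have KL: "K * L = 1\<^sub>m n" and LK: "L * K = 1\<^sub>m (dim_row L)"
      using that K by (simp_all add: inverts_mat_def)
    \<comment> \<open>The two products being identity matrices forces \<open>L\<close> to be square of the size of \<open>K\<close>.\<close>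
    have "dim_col L = n" "dim_row L = n"
      using arg_cong[OF KL, of dim_col] arg_cong[OF LK, of dim_col] K by simp_all
    then have L: "L \<in> carrier_mat n n"
      by auto
    have "L = (B * K * B) * K * L"
      using left L by simp
    also have "\<dots> = B * K * B"
      using assoc_mult_mat[OF C K L] KL right_mult_one_mat[OF C] by simp
    finally have "similar_mat L K"
      using K L B BB by (intro similar_matI[of _ _ B B n]) auto
    then show ?thesis
      by (simp add: spectrum_mset_def char_poly_similar)
  qed
  ultimately show ?thesis
    by (simp add: K_def)
qed

end
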